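(* Let $S$ be a multiplicative subset of a commutative ring $R$ with nonzero identity, $M$ an $R$-module, and $N\leq M$ a submodule. Then: (1) If $N$ is $u$-$S$-torsion and $N$ is $u$-$S$-essential in $M$, then $M$ is $u$-$S$-torsion. (2) $M$ is $u$-$S$-torsion if and only if every submodule of $M$ is $u$-$S$-essential in $M$.
   Context: A multiplicative subset $S$ of $R$ satisfies $1\in S$, $0\notin S$, and $s_1s_2\in S$ for all $s_1,s_2\in S$. All modules are unitary. An $R$-module $X$ is $u$-$S$-torsion if there exists $s\in S$ with $sX=0$. A submodule $N$ of $M$ is $u$-$S$-essential in $M$ if for every submodule $L$ of $M$, $N\cap L$ being $u$-$S$-torsion implies that $L$ is $u$-$S$-torsion. *)

theory Defs
  imports "HOL-Algebra.Module"
begin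

definition multiplicative_subset :: "('a, 'r) ring_scheme \<Rightarrow> 'a set \<Rightarrow> bool" where
  "multiplicative_subset R S \<longleftrightarrow>
     S \<subseteq> carrier R \<and> \<one>\<^bsub>R\<^esub> \<in> S \<and> \<zero>\<^bsub>R\<^esub> \<notin> S \<and>
     (\<forall>s\<^sub>1\<in>S. \<forall>s\<^sub>2\<in>S. s\<^sub>1 \<otimes>\<^bsub>R\<^esub> s\<^sub>2 \<in> S)"

definition u_S_torsion :: "'a set \<Rightarrow> ('a, 'b, 'm) module_scheme \<Rightarrow> bool" where
  "u_S_torsion S X \<longleftrightarrow> (\<exists>s\<in>S. (\<lambda>x. s \<odot>\<^bsub>X\<^esub> x) ` carrier X = {\<zero>\<^bsub>X\<^esub>})"

text \<open>A submodule is a subset of the carrier of \<open>M\<close>; regarded as a module in its own right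
  it is \<open>M\<close> with the carrier replaced, as in \<open>submodule.submodule_is_module\<close>.\<close>

definition u_S_essential ::
  "('a, 'r) ring_scheme \<Rightarrow> 'a set \<Rightarrow> ('a, 'b, 'm) module_scheme \<Rightarrow> 'b set \<Rightarrow> bool" where
  "u_S_essential R S M N \<longleftrightarrow>
     submodule N R M \<and>
     (\<forall>L. submodule L R M \<longrightarrow>
        u_S_torsion S (M\<lparr>carrier := N \<inter> L\<rparr>) \<longrightarrow> u_S_torsion S (M\<lparr>carrier := L\<rparr>))"

end

theory Submission
  imports Defs
begin

text \<open>Essentiality of a submodule \<open>K\<close>, tested on the whole module, says that
  \<open>M\<close> is torsion as soon as \<open>K\<close> is; this is (1). For (2), if
  \<open>M\<close> is torsion then so is every submodule (\<open>u_S_torsion_mono\<close>), so the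
  conclusion demanded by essentiality always holds. Conversely, the zero submodule is torsion, and
  if it is essential, (1) makes \<open>M\<close> torsion.\<close>

lemma u_S_torsion_mono:
  assumes "u_S_torsion S M" and "K \<subseteq> carrier M" and "K \<noteq> {}"
  shows "u_S_torsion S (M\<lparr>carrier := K\<rparr>)"
proof -
  obtain s where "s \<in> S" and s: "(\<lambda>x. s \<odot>\<^bsub>M\<^esub> x) ` carrier M = {\<zero>\<^bsub>M\<^esub>}"
    using assms(1) unfolding u_S_torsion_def by blast
  \<comment> \<open>The same \<open>s\<close> kills \<open>K\<close>. Torsion asks for an image
    equal to the zero singleton, so \<open>K\<close> must be nonempty.\<close>
  have "(\<lambda>x. s \<odot>\<^bsub>M\<^esub> x) ` K = {\<zero>\<^bsub>M\<^esub>}"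
    using image_mono[OF assms(2), of "\<lambda>x. s \<odot>\<^bsub>M\<^esub> x"] assms(3) unfolding s by (simp add: subset_singleton_iff)
  with \<open>s \<in> S\<close> show ?thesis
    unfolding u_S_torsion_def by auto
qed

lemma (in module) submodule_zero: "submodule {\<zero>\<^bsub>M\<^esub>} R M"
  by (rule submoduleI) auto

theorem proposition2p6:
  fixes R :: "('a, 'r) ring_scheme" and M :: "('a, 'b, 'm) module_scheme"
    and S :: "'a set" and N :: "'b set"
  assumes "cring R" and "\<one>\<^bsub>R\<^esub> \<noteq> \<zero>\<^bsub>R\<^esub>"
    and "multiplicative_subset R S"
    and "module R M" and "submodule N R M"
  shows "(u_S_torsion S (M\<lparr>carrier := N\<rparr>) \<and> u_S_essential R S M N \<longrightarrow> u_S_torsion S M) \<and>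
    (u_S_torsion S M \<longleftrightarrow> (\<forall>K. submodule K R M \<longrightarrow> u_S_essential R S M K))"
proof -
  interpret module R M by fact
  have torsion: "u_S_torsion S M"
    if "u_S_essential R S M K" and "u_S_torsion S (M\<lparr>carrier := K\<rparr>)" for K
  proof -
    \<comment> \<open>Essentiality is tested on \<open>L = carrier M\<close>, where the intersection
      is \<open>K\<close> itself.\<close>
    have "K \<inter> carrier M = K"
      using that(1) submoduleE(1) unfolding u_S_essential_def by blast
    with that carrier_is_submodule have "u_S_torsion S (M\<lparr>carrier := carrier M\<rparr>)"
      unfolding u_S_essential_def by metis
    then show ?thesis
      by simp
  qed
  have "u_S_essential R S M K" if "u_S_torsion S M" and "submodule K R M" for K
    using that unfolding u_S_essential_def
    by (simp add: u_S_torsion_mono submoduleE(1,2))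
  \<comment> \<open>The witness is the unit, which lies in \<open>S\<close>; with this,
    \<open>torsion\<close> applies to the zero submodule.\<close>
  moreover have "u_S_torsion S (M\<lparr>carrier := {\<zero>\<^bsub>M\<^esub>}\<rparr>)"
    using assms(3) unfolding u_S_torsion_def multiplicative_subset_def
    by (intro bexI[of _ "\<one>\<^bsub>R\<^esub>"]) auto
  ultimately show ?thesis
    using torsion submodule_zero by blast
qed

end
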